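(* Let $\Omega:=\bigcup_{j=1}^\infty(4^j,4^j+2^j)\subset\mathbb{R}$, where $\mathbb{R}$ is equipped with the Euclidean distance and Lebesgue measure. Then $\Omega$ does not satisfy the weak measure density (WMD) condition, and there exists $f\in L^1(\Omega)\cap\bigcup_{s\in(0,1)}\dot{W}^{s,1}(\Omega)$ such that $\|f\|_{L^1(\Omega)}\in(0,\infty)$ and $$\lim_{s\to0^+}s\int_\Omega\int_\Omega\frac{|f(x)-f(y)|}{|x-y|^{1+s}}\,dy\,dx=0.$$ Consequently, there do not exist positive constants $C,\widetilde C$ such that, for all $f\in[L^1(\Omega)/\mathbb{R}]\cap\bigcup_{s\in(0,1)}\dot{W}^{s,1}(\Omega)$, $$C\|f\|_{L^1(\Omega)/\mathbb{R}}\le\liminf_{s\to0^+}s\int_\Omega\int_\Omega\frac{|f(x)-f(y)|}{|x-y|^{1+s}}\,dy\,dx\le\limsup_{s\to0^+}s\int_\Omega\int_\Omega\frac{|f(x)-f(y)|}{|x-y|^{1+s}}\,dy\,dx\le\widetilde C\|f\|_{L^1(\Omega)/\mathbb{R}}.$$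
   Context: A measurable set $\Omega\subseteq\mathbb{R}$ satisfies the WMD condition if there exist $x_0\in\mathbb{R}$ and $C_0\in(0,1]$ with $\liminf_{r\to\infty}\frac{|B(x_0,r)\cap\Omega|}{|B(x_0,r)|}\ge C_0$, where $B(x_0,r)=(x_0-r,x_0+r)$ and $|\cdot|$ is Lebesgue measure. $\dot W^{s,1}(\Omega)$ is the set of measurable $f$ on $\Omega$ with $\int_\Omega\int_\Omega\frac{|f(x)-f(y)|}{|x-y|^{1+s}}dy\,dx<\infty$. $L^1(\Omega)/\mathbb{R}$ is the set of measurable $f$ on $\Omega$ (modulo additive real constants) with $\|f\|_{L^1(\Omega)/\mathbb{R}}:=\inf_{a\in\mathbb{R}}\|f+a\|_{L^1(\Omega)}<\infty$. $s\to0^+$ means $s\in(0,1)$, $s\to0$. *)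

theory Defs
  imports "HOL-Analysis.Analysis"
begin

text \<open>Functions on \<open>\<Omega>\<close> are represented by functions on the whole line; every notion below only
  depends on the values on \<open>\<Omega>\<close>. "Measurable" means Lebesgue measurable. Measurability of \<open>\<Omega>\<close> is
  not part of the predicates and is to be ensured separately.\<close>

definition WMD :: "real set \<Rightarrow> bool" where
  "WMD \<Omega> \<longleftrightarrow> (\<exists>x0. \<exists>C0\<in>{0<..1}.
     Liminf at_top (\<lambda>r. ereal (measure lebesgue (ball x0 r \<inter> \<Omega>) / measure lebesgue (ball x0 r)))
       \<ge> ereal C0)"

text \<open>On the diagonal the integrand is \<open>0 / 0 = 0\<close>; this is a null set for the inner integral.\<close>

definition gagliardo :: "real set \<Rightarrow> real \<Rightarrow> (real \<Rightarrow> real) \<Rightarrow> ennreal" where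
  "gagliardo \<Omega> s f =
     (\<integral>\<^sup>+x. (\<integral>\<^sup>+y. ennreal (\<bar>f x - f y\<bar> / \<bar>x - y\<bar> powr (1 + s)) \<partial>lebesgue_on \<Omega>) \<partial>lebesgue_on \<Omega>)"

definition W_dot :: "real \<Rightarrow> real set \<Rightarrow> (real \<Rightarrow> real) set" where
  "W_dot s \<Omega> = {f \<in> borel_measurable (lebesgue_on \<Omega>). gagliardo \<Omega> s f < \<infinity>}"

definition L1_norm :: "real set \<Rightarrow> (real \<Rightarrow> real) \<Rightarrow> ennreal" where
  "L1_norm \<Omega> f = (\<integral>\<^sup>+x. ennreal \<bar>f x\<bar> \<partial>lebesgue_on \<Omega>)"

definition L1 :: "real set \<Rightarrow> (real \<Rightarrow> real) set" where
  "L1 \<Omega> = {f. integrable (lebesgue_on \<Omega>) f}"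

definition L1_mod_norm :: "real set \<Rightarrow> (real \<Rightarrow> real) \<Rightarrow> ennreal" where
  "L1_mod_norm \<Omega> f = (INF a. L1_norm \<Omega> (\<lambda>x. f x + a))"

text \<open>The space of functions modulo additive constants is given by its representatives. Both
  \<open>L1_mod_norm\<close> and \<open>gagliardo\<close> are invariant under adding a constant.\<close>

definition L1_mod :: "real set \<Rightarrow> (real \<Rightarrow> real) set" where
  "L1_mod \<Omega> = {f \<in> borel_measurable (lebesgue_on \<Omega>). L1_mod_norm \<Omega> f < \<infinity>}"

definition Omega :: "real set" where
  "Omega = (\<Union>j\<in>{1::nat..}. {4 ^ j <..< 4 ^ j + 2 ^ j})"

lemma Omega_measurable: "Omega \<in> sets lebesgue"
  unfolding Omega_def by (intro sets.countable_UN') auto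

end

theory Submission
  imports Defs "HOL-Real_Asymp.Real_Asymp"
begin

text \<open>
  The blocks of \<^term>\<open>Omega\<close> have length \<open>2\<^sup>j\<close>, which is the square root of their distance \<open>4\<^sup>j\<close>
  from the origin. This has two consequences: the part of \<^term>\<open>Omega\<close> to the left of \<open>R\<close> has measure
  of order \<open>sqrt R\<close>, so that its density at infinity vanishes, and the integral of \<open>1 / y\<close> over
  \<^term>\<open>Omega\<close> converges, being at most the sum of the \<open>2\<^sup>j / 4\<^sup>j\<close>.

  On the line, the factor \<open>s\<close> in front of the Gagliardo integral is compensated by the divergence of
  the integral of \<open>1 / y\<^bsup>1+s\<^esup>\<close> at infinity, which is of order \<open>1 / s\<close>. On \<^term>\<open>Omega\<close> that integral stays
  bounded as \<open>s\<close> tends to \<open>0\<close>. Hence for the indicator \<open>f\<close> of the first block \<open>(4, 6)\<close>, whose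
  distance from the other blocks is positive, so that the kernel has no singularity where
  \<open>f x \<noteq> f y\<close>, the Gagliardo integral is bounded uniformly in \<open>s\<close>, and \<open>s\<close> times it tends to \<open>0\<close>.
  This \<open>f\<close> is not almost everywhere constant on \<^term>\<open>Omega\<close>, so its norm modulo constants is positive,
  and no lower bound by a multiple of that norm can hold.
\<close>

section \<open>The size of the set at infinity\<close>

lemma Omega_E:
  assumes "x \<in> Omega"
  obtains j where "j \<ge> 1" "4 ^ j < x" "x < 4 ^ j + 2 ^ j"
  using assms unfolding Omega_def by auto

lemma Omega_gt_4:
  assumes "x \<in> Omega"
  shows "4 < x"
proof -
  obtain j :: nat where j: "j \<ge> 1" "4 ^ j < x" using Omega_E[OF assms] by metis
  have "(4::real) ^ 1 \<le> 4 ^ j" by (rule power_increasing[OF j(1)]) simp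
  with j show ?thesis by simp
qed

lemma first_block_subset: "{4<..<6} \<subseteq> Omega"
  unfolding Omega_def by (rule subset_trans[OF _ UN_upper[of 1]]) auto

lemma second_block_subset: "{16<..<20} \<subseteq> Omega"
  unfolding Omega_def by (rule subset_trans[OF _ UN_upper[of 2]]) auto

lemma Omega_outside_first_block:
  assumes "x \<in> Omega" "x \<notin> {4<..<6}"
  shows "16 < x"
proof -
  obtain j :: nat where j: "j \<ge> 1" "4 ^ j < x" "x < 4 ^ j + 2 ^ j"
    using Omega_E[OF assms(1)] by metis
  have "j \<noteq> 1" using assms(2) j by auto
  then have "(4::real) ^ 2 \<le> 4 ^ j" using j(1) by (intro power_increasing) auto
  with j show ?thesis by simp
qed

text \<open>If \<open>4\<^sup>n \<le> R < 4\<^bsup>n+1\<^esup>\<close>, only the first \<open>n\<close> blocks start to the left of \<open>R\<close>, and their lengths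
  add up to less than \<open>2\<^bsup>n+1\<^esup> \<le> 2 sqrt R\<close>.\<close>

lemma emeasure_Omega_lessThan:
  assumes "1 \<le> R"
  shows "emeasure lebesgue (Omega \<inter> {..<R}) \<le> ennreal (2 * sqrt R)"
proof -
  obtain m :: nat where "R < 4 ^ m" using real_arch_pow[of 4 R] by auto
  with assms obtain n :: nat where n: "4 ^ n \<le> R" "R < 4 ^ (n + 1)"
    using ex_least_nat_less[of "\<lambda>n. R < 4 ^ n" m] by (force simp: not_less)
  define I :: "nat \<Rightarrow> real set" where "I = (\<lambda>j. {4 ^ j <..< 4 ^ j + 2 ^ j})"
  have "Omega \<inter> {..<R} \<subseteq> (\<Union>j\<in>{..n}. I j)"
  proof
    fix x assume x: "x \<in> Omega \<inter> {..<R}"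
    then obtain j :: nat where j: "4 ^ j < x" "x < 4 ^ j + 2 ^ j" by (auto elim: Omega_E)
    have "(4::real) ^ j < 4 ^ (n + 1)" using j x n by auto
    then have "j < n + 1" by (rule power_less_imp_less_exp[rotated]) simp
    then show "x \<in> (\<Union>j\<in>{..n}. I j)" using j by (auto simp: I_def intro!: bexI[of _ j])
  qed
  then have "emeasure lebesgue (Omega \<inter> {..<R}) \<le> emeasure lebesgue (\<Union>j\<in>{..n}. I j)"
    by (rule emeasure_mono) (auto simp: I_def)
  also have "\<dots> \<le> (\<Sum>j\<le>n. emeasure lebesgue (I j))"
    by (rule emeasure_subadditive_finite) (auto simp: I_def)
  also have "\<dots> = (\<Sum>j\<le>n. ennreal (2 ^ j))"
    by (simp add: I_def)
  also have "\<dots> = ennreal (\<Sum>j\<le>n. 2 ^ j)"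
    by (rule sum_ennreal) simp
  also have "(\<Sum>j\<le>n. 2 ^ j) \<le> 2 * (2 ^ n :: real)"
    by (induction n) auto
  also have "(2::real) ^ n = sqrt (4 ^ n)"
    by (rule real_sqrt_unique[symmetric]) (auto simp: power2_eq_square power_mult_distrib[symmetric])
  also have "sqrt (4 ^ n) \<le> sqrt R" using n by simp
  finally show ?thesis by (simp add: ennreal_leI)
qed

lemma Omega_density_le:
  assumes "1 \<le> x0 + r" "0 < r"
  shows "measure lebesgue (ball x0 r \<inter> Omega) / measure lebesgue (ball x0 r) \<le> sqrt (x0 + r) / r"
proof -
  have "ball x0 r \<inter> Omega \<subseteq> Omega \<inter> {..<x0 + r}"
    by (auto simp: dist_real_def)
  then have "emeasure lebesgue (ball x0 r \<inter> Omega) \<le> emeasure lebesgue (Omega \<inter> {..<x0 + r})"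
    by (rule emeasure_mono) (intro sets.Int Omega_measurable, simp)
  also have "\<dots> \<le> ennreal (2 * sqrt (x0 + r))"
    by (rule emeasure_Omega_lessThan) fact
  finally have "measure lebesgue (ball x0 r \<inter> Omega) \<le> 2 * sqrt (x0 + r)"
    unfolding measure_def using assms by (intro enn2real_leI) auto
  moreover have "measure lebesgue (ball x0 r) = 2 * r"
    using assms by (simp add: ball_eq_greaterThanLessThan)
  ultimately show ?thesis using assms by (simp add: field_simps)
qed

lemma not_WMD_Omega: "\<not> WMD Omega"
proof
  assume "WMD Omega"
  then obtain x0 C0 where C0: "C0 \<in> {0<..1}" and le:
    "Liminf at_top (\<lambda>r. ereal (measure lebesgue (ball x0 r \<inter> Omega) / measure lebesgue (ball x0 r)))
      \<ge> ereal C0" (is "Liminf _ ?d \<ge> _") unfolding WMD_def by blast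
  have "((\<lambda>r. sqrt (x0 + r) / r) \<longlongrightarrow> 0) at_top" by real_asymp
  moreover have "\<forall>\<^sub>F r in at_top. 0 < r \<and> 1 \<le> x0 + r"
    using eventually_ge_at_top[of "max 1 (1 - x0)"] by eventually_elim auto
  ultimately have "((\<lambda>r. measure lebesgue (ball x0 r \<inter> Omega) / measure lebesgue (ball x0 r)) \<longlongrightarrow> 0) at_top"
  proof (elim tendsto_sandwich[OF _ _ tendsto_const, rotated 2])
    show "\<forall>\<^sub>F r in at_top. 0 \<le> measure lebesgue (ball x0 r \<inter> Omega) / measure lebesgue (ball x0 r)"
      by simp
  qed (elim eventually_mono, intro Omega_density_le, auto)
  then have "Liminf at_top ?d = 0"
    by (intro lim_imp_Liminf) (auto simp: zero_ereal_def)
  with le C0 show False by simp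
qed

lemma inverse_integral_Omega: "(\<integral>\<^sup>+y. ennreal (1 / y) \<partial>lebesgue_on Omega) \<le> 2"
proof -
  define I :: "nat \<Rightarrow> real set" where "I = (\<lambda>j. {4 ^ j <..< 4 ^ j + 2 ^ j})"
  have "(\<integral>\<^sup>+y. ennreal (1 / y) \<partial>lebesgue_on Omega) = (\<integral>\<^sup>+y. ennreal (1 / y) * indicator Omega y \<partial>lebesgue)"
    by (rule nn_integral_restrict_space) (use Omega_measurable in auto)
  also have "\<dots> \<le> (\<integral>\<^sup>+y. (\<Sum>j. ennreal (1 / 4 ^ j) * indicator (I j) y) \<partial>lebesgue)"
  proof (rule nn_integral_mono)
    fix y :: real
    show "ennreal (1 / y) * indicator Omega y \<le> (\<Sum>j. ennreal (1 / 4 ^ j) * indicator (I j) y)"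
    proof (cases "y \<in> Omega")
      case True
      then obtain j :: nat where j: "4 ^ j < y" "y < 4 ^ j + 2 ^ j" by (auto elim: Omega_E)
      have "1 / y \<le> 1 / 4 ^ j"
        using j by (intro divide_left_mono mult_pos_pos) (auto intro: less_trans[of 0 "4 ^ j" y])
      then have "ennreal (1 / y) * indicator Omega y \<le> ennreal (1 / 4 ^ j) * indicator (I j) y"
        using j True by (simp add: I_def ennreal_leI)
      also have "\<dots> = (\<Sum>i\<in>{j}. ennreal (1 / 4 ^ i) * indicator (I i) y)"
        by (simp only: sum.insert sum.empty finite.emptyI empty_iff not_False_eq_True add_0_right)
      also have "\<dots> \<le> (\<Sum>i. ennreal (1 / 4 ^ i) * indicator (I i) y)"
        by (rule sum_le_suminf) auto
      finally show ?thesis .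
    qed simp
  qed
  also have "\<dots> = (\<Sum>j. \<integral>\<^sup>+y. ennreal (1 / 4 ^ j) * indicator (I j) y \<partial>lebesgue)"
    unfolding I_def by (intro nn_integral_suminf measurable_completion) measurable
  also have "\<dots> = (\<Sum>j. ennreal ((1 / 2) ^ j))"
  proof (rule suminf_cong)
    fix j :: nat
    have "(\<integral>\<^sup>+y. ennreal (1 / 4 ^ j) * indicator (I j) y \<partial>lebesgue) = ennreal (1 / 4 ^ j) * ennreal (2 ^ j)"
      by (subst nn_integral_cmult_indicator) (auto simp: I_def)
    also have "\<dots> = ennreal (1 / 4 ^ j * 2 ^ j)" by (rule ennreal_mult[symmetric]) simp_all
    also have "1 / 4 ^ j * 2 ^ j = (1 / 2 :: real) ^ j"
      by (simp add: power_divide field_simps power_mult_distrib[symmetric])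
    finally show "(\<integral>\<^sup>+y. ennreal (1 / 4 ^ j) * indicator (I j) y \<partial>lebesgue) = ennreal ((1 / 2) ^ j)" .
  qed
  also have "\<dots> = ennreal 2"
    using geometric_sums[of "1 / 2 :: real"] by (intro suminf_ennreal_eq) auto
  finally show ?thesis by simp
qed

section \<open>The indicator of the first block\<close>

abbreviation first_block_ind :: "real \<Rightarrow> real" where
  "first_block_ind \<equiv> indicator {4<..<6}"

lemma first_block_ind_measurable [measurable]:
  "first_block_ind \<in> borel_measurable (lebesgue_on Omega)"
  by (intro measurable_restrict_space1 measurable_completion) simp

lemma L1_norm_first_block_ind: "L1_norm Omega first_block_ind = 2"
proof -
  have "L1_norm Omega first_block_ind = (\<integral>\<^sup>+x. indicator {4<..<6} x \<partial>lebesgue_on Omega)"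
    unfolding L1_norm_def by (intro nn_integral_cong) (simp split: split_indicator)
  also have "\<dots> = emeasure (lebesgue_on Omega) {4<..<6}"
    using first_block_subset Omega_measurable
    by (intro nn_integral_indicator) (simp add: sets_restrict_space_iff)
  also have "\<dots> = emeasure lebesgue {4::real<..<6}"
    using first_block_subset Omega_measurable by (intro emeasure_restrict_space) auto
  finally show ?thesis by simp
qed

text \<open>Two points of \<^term>\<open>Omega\<close> at which the indicator differs are \<open>u \<in> (4, 6)\<close> and \<open>v > 16\<close>, hence
  \<open>v - u \<ge> v / 2 \<ge> 1\<close>. As this distance is at least \<open>1\<close>, the exponent \<open>1 + s\<close> may be lowered to \<open>1\<close>,
  which makes the bound independent of \<open>s\<close>; its two factors depend on one variable each.\<close>

lemma gagliardo_kernel_le: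
  assumes s: "0 \<le> s" and x: "x \<in> Omega" and y: "y \<in> Omega"
  shows "\<bar>first_block_ind x - first_block_ind y\<bar> / \<bar>x - y\<bar> powr (1 + s)
    \<le> 2 * (first_block_ind x * (1 / y) + first_block_ind y * (1 / x))"
proof -
  have pos: "0 < x" "0 < y" using Omega_gt_4 x y by fastforce+
  have key: "1 / \<bar>u - v\<bar> powr (1 + s) \<le> 2 / v" if "u < 6" "16 < v" for u v :: real
  proof -
    have "v / 2 \<le> \<bar>u - v\<bar> powr 1" using that by simp
    also have "\<dots> \<le> \<bar>u - v\<bar> powr (1 + s)" using that s by (intro powr_mono) auto
    finally have "1 / \<bar>u - v\<bar> powr (1 + s) \<le> 1 / (v / 2)"
      using that by (intro divide_left_mono) auto
    then show ?thesis by simp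
  qed
  consider "x \<in> {4<..<6} \<longleftrightarrow> y \<in> {4<..<6}" | "x \<in> {4<..<6}" "y \<notin> {4<..<6}" | "x \<notin> {4<..<6}" "y \<in> {4<..<6}"
    by blast
  then show ?thesis
  proof cases
    case 1
    then show ?thesis using pos by (simp add: indicator_def)
  next
    case 2
    then show ?thesis using key[of x y] Omega_outside_first_block[OF y] by simp
  next
    case 3
    then show ?thesis using key[of y x] Omega_outside_first_block[OF x] by (simp add: abs_minus_commute)
  qed
qed

lemma gagliardo_first_block_ind:
  assumes s: "0 \<le> s"
  shows "gagliardo Omega s first_block_ind \<le> 16"
proof -
  define M where "M = lebesgue_on Omega"
  define f :: "real \<Rightarrow> ennreal" where "f = (\<lambda>x. ennreal \<bar>first_block_ind x\<bar>)"
  define g :: "real \<Rightarrow> ennreal" where "g = (\<lambda>x. ennreal (1 / x))"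
  have [measurable]: "f \<in> borel_measurable M" "g \<in> borel_measurable M"
    unfolding f_def g_def M_def
    by (intro measurable_restrict_space1 measurable_completion, measurable)+
  have f: "(\<integral>\<^sup>+x. f x \<partial>M) = 2"
    using L1_norm_first_block_ind unfolding L1_norm_def f_def M_def .
  have g: "(\<integral>\<^sup>+x. g x \<partial>M) \<le> 2"
    using inverse_integral_Omega unfolding g_def M_def .
  have "gagliardo Omega s first_block_ind \<le> (\<integral>\<^sup>+x. \<integral>\<^sup>+y. 2 * (f x * g y + f y * g x) \<partial>M \<partial>M)"
    unfolding gagliardo_def M_def[symmetric]
  proof (intro nn_integral_mono)
    fix x y assume "x \<in> space M" "y \<in> space M"
    then have xy: "x \<in> Omega" "y \<in> Omega" by (auto simp: M_def)
    have pos: "0 < x" "0 < y" using Omega_gt_4 xy by fastforce+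
    have "ennreal (\<bar>first_block_ind x - first_block_ind y\<bar> / \<bar>x - y\<bar> powr (1 + s))
      \<le> ennreal (2 * (first_block_ind x * (1 / y) + first_block_ind y * (1 / x)))"
      by (intro ennreal_leI gagliardo_kernel_le s xy)
    also have "\<dots> = ennreal 2 * (ennreal (first_block_ind x * (1 / y)) + ennreal (first_block_ind y * (1 / x)))"
      using pos by (subst ennreal_mult, simp, simp, subst ennreal_plus) auto
    also have "\<dots> = 2 * (f x * g y + f y * g x)"
      using pos unfolding f_def g_def by (subst (1 2) ennreal_mult) auto
    finally show "ennreal (\<bar>first_block_ind x - first_block_ind y\<bar> / \<bar>x - y\<bar> powr (1 + s))
      \<le> 2 * (f x * g y + f y * g x)" .
  qed
  also have "\<dots> = (\<integral>\<^sup>+x. 2 * (f x * (\<integral>\<^sup>+y. g y \<partial>M) + (\<integral>\<^sup>+y. f y \<partial>M) * g x) \<partial>M)"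
    by (simp add: nn_integral_cmult nn_integral_multc nn_integral_add)
  also have "\<dots> = 2 * (2 * (\<integral>\<^sup>+y. g y \<partial>M) + 2 * (\<integral>\<^sup>+y. g y \<partial>M))"
    by (simp add: nn_integral_cmult nn_integral_multc nn_integral_add f)
  also have "\<dots> \<le> 2 * (2 * 2 + 2 * 2)"
    by (intro mult_left_mono add_mono g) auto
  finally show ?thesis by simp
qed

lemma gagliardo_first_block_ind_tendsto:
  "((\<lambda>s. ennreal s * gagliardo Omega s first_block_ind) \<longlongrightarrow> 0) (at_right 0)"
proof (rule tendsto_sandwich[OF _ _ tendsto_const])
  show "\<forall>\<^sub>F s in at_right 0. ennreal s * gagliardo Omega s first_block_ind \<le> ennreal (s * 16)"
    using eventually_at_right_less[of "0::real"]
  proof eventually_elim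
    case (elim s)
    then have "ennreal s * gagliardo Omega s first_block_ind \<le> ennreal s * 16"
      by (intro mult_left_mono gagliardo_first_block_ind) auto
    then show ?case using elim by (simp add: ennreal_mult)
  qed
  have "((\<lambda>s::real. s * 16) \<longlongrightarrow> 0) (at_right 0)" by real_asymp
  from tendsto_ennrealI[OF this]
  show "((\<lambda>s. ennreal (s * 16)) \<longlongrightarrow> 0) (at_right 0)" by simp
qed simp

text \<open>A constant \<open>a\<close> can make \<open>f + a\<close> small on at most one of the blocks \<open>(4, 6)\<close> and \<open>(16, 20)\<close>, as
  \<open>1 \<le> \<bar>1 + a\<bar> + \<bar>a\<bar>\<close>. Both blocks have length at least \<open>2\<close>.\<close>

lemma L1_mod_norm_first_block_ind: "2 \<le> L1_mod_norm Omega first_block_ind"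
  unfolding L1_mod_norm_def
proof (rule INF_greatest)
  fix a :: real
  have "2 = ennreal 2" by simp
  also have "\<dots> \<le> ennreal (\<bar>1 + a\<bar> * 2 + \<bar>a\<bar> * 4)" by (rule ennreal_leI) (auto simp: abs_if)
  also have "\<dots> = ennreal \<bar>1 + a\<bar> * emeasure lebesgue {4::real<..<6} + ennreal \<bar>a\<bar> * emeasure lebesgue {16::real<..<20}"
    by (simp add: ennreal_mult ennreal_plus)
  also have "\<dots> = (\<integral>\<^sup>+x. ennreal \<bar>1 + a\<bar> * indicator {4::real<..<6} x + ennreal \<bar>a\<bar> * indicator {16<..<20} x \<partial>lebesgue)"
    by (subst nn_integral_add, (intro measurable_completion, measurable)+)
       (simp add: nn_integral_cmult_indicator)
  also have "\<dots> \<le> (\<integral>\<^sup>+x. ennreal \<bar>first_block_ind x + a\<bar> * indicator Omega x \<partial>lebesgue)"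
    using first_block_subset second_block_subset
    by (intro nn_integral_mono) (auto split: split_indicator)
  also have "\<dots> = L1_norm Omega (\<lambda>x. first_block_ind x + a)"
    unfolding L1_norm_def
    by (rule nn_integral_restrict_space[symmetric]) (use Omega_measurable in auto)
  finally show "2 \<le> L1_norm Omega (\<lambda>x. first_block_ind x + a)" .
qed

lemma first_block_ind_in_L1: "first_block_ind \<in> L1 Omega"
  unfolding L1_def using L1_norm_first_block_ind
  by (simp add: integrable_iff_bounded L1_norm_def)

lemma L1_subset_L1_mod: "L1 \<Omega> \<subseteq> L1_mod \<Omega>"
proof
  fix f assume "f \<in> L1 \<Omega>"
  then have f: "f \<in> borel_measurable (lebesgue_on \<Omega>)" "L1_norm \<Omega> f < \<infinity>"
    by (auto simp: L1_def L1_norm_def integrable_iff_bounded)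
  have "L1_mod_norm \<Omega> f \<le> L1_norm \<Omega> (\<lambda>x. f x + 0)"
    unfolding L1_mod_norm_def by (rule INF_lower) simp
  with f show "f \<in> L1_mod \<Omega>" by (auto simp: L1_mod_def)
qed

lemma first_block_ind_in_W_dot: "first_block_ind \<in> (\<Union>s\<in>{0<..<1}. W_dot s Omega)"
proof
  show "first_block_ind \<in> W_dot (1 / 2) Omega"
    using gagliardo_first_block_ind[of "1 / 2"] by (auto simp: W_dot_def intro: le_less_trans)
qed simp

section \<open>Failure of the weak measure density condition and of the limiting formula\<close>

theorem proposition3p8:
  shows "\<not> WMD Omega
    \<and> (\<exists>f \<in> L1 Omega \<inter> (\<Union>s\<in>{0<..<1}. W_dot s Omega).
          0 < L1_norm Omega f \<and> L1_norm Omega f < \<infinity>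
        \<and> ((\<lambda>s. ennreal s * gagliardo Omega s f) \<longlongrightarrow> 0) (at_right 0))
    \<and> \<not> (\<exists>C C'. 0 < (C::real) \<and> 0 < (C'::real) \<and>
          (\<forall>f \<in> L1_mod Omega \<inter> (\<Union>s\<in>{0<..<1}. W_dot s Omega).
              ennreal C * L1_mod_norm Omega f
                \<le> Liminf (at_right 0) (\<lambda>s. ennreal s * gagliardo Omega s f)
            \<and> Liminf (at_right 0) (\<lambda>s. ennreal s * gagliardo Omega s f)
                \<le> Limsup (at_right 0) (\<lambda>s. ennreal s * gagliardo Omega s f)
            \<and> Limsup (at_right 0) (\<lambda>s. ennreal s * gagliardo Omega s f)
                \<le> ennreal C' * L1_mod_norm Omega f))"
proof (intro conjI notI)
  show "WMD Omega \<Longrightarrow> False" using not_WMD_Omega by blast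
  show "\<exists>f \<in> L1 Omega \<inter> (\<Union>s\<in>{0<..<1}. W_dot s Omega).
          0 < L1_norm Omega f \<and> L1_norm Omega f < \<infinity>
        \<and> ((\<lambda>s. ennreal s * gagliardo Omega s f) \<longlongrightarrow> 0) (at_right 0)"
    using first_block_ind_in_L1 first_block_ind_in_W_dot L1_norm_first_block_ind
      gagliardo_first_block_ind_tendsto
    by (intro bexI[of _ first_block_ind]) auto
next
  assume "\<exists>C C'. 0 < (C::real) \<and> 0 < (C'::real) \<and>
          (\<forall>f \<in> L1_mod Omega \<inter> (\<Union>s\<in>{0<..<1}. W_dot s Omega).
              ennreal C * L1_mod_norm Omega f
                \<le> Liminf (at_right 0) (\<lambda>s. ennreal s * gagliardo Omega s f)
            \<and> Liminf (at_right 0) (\<lambda>s. ennreal s * gagliardo Omega s f)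
                \<le> Limsup (at_right 0) (\<lambda>s. ennreal s * gagliardo Omega s f)
            \<and> Limsup (at_right 0) (\<lambda>s. ennreal s * gagliardo Omega s f)
                \<le> ennreal C' * L1_mod_norm Omega f)"
  moreover have "first_block_ind \<in> L1_mod Omega \<inter> (\<Union>s\<in>{0<..<1}. W_dot s Omega)"
    using first_block_ind_in_L1 first_block_ind_in_W_dot L1_subset_L1_mod by blast
  ultimately obtain C :: real where C: "0 < C" "ennreal C * L1_mod_norm Omega first_block_ind
      \<le> Liminf (at_right 0) (\<lambda>s. ennreal s * gagliardo Omega s first_block_ind)"
    by blast
  moreover have "Liminf (at_right 0) (\<lambda>s. ennreal s * gagliardo Omega s first_block_ind) = 0"
    by (rule lim_imp_Liminf[OF _ gagliardo_first_block_ind_tendsto]) simp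
  ultimately have "L1_mod_norm Omega first_block_ind = 0" by simp
  with L1_mod_norm_first_block_ind show False by simp
qed

end
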